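(* The Riccati equation $$\begin{cases}\dfrac{dP}{dt}+PA+A^*P+C^*PC+M-L^*K^{-1}L=0&\text{in }[0,T),\\ P(T)=G,\end{cases}\qquad L=B^*P+D^*PC,\quad K=R+D^*PD,$$ admits at most one strongly regular mild solution.
   Context: $T>0$; $H$ is a separable real Hilbert space, $U$ a real Hilbert space, $A$ generates a $C_0$-semigroup $S(\cdot)$ on $H$; $\mathbb S(\cdot)$ denotes bounded self-adjoint operators. The (deterministic) coefficients satisfy $B,D\in L^\infty(0,T;\mathcal L(U;H))$, $C\in L^\infty(0,T;\mathcal L(H))$, $G\in\mathbb S(H)$, $M\in L^1(0,T;\mathbb S(H))$, $R\in L^\infty(0,T;\mathbb S(U))$. $C_{\mathcal S}([0,T];\mathbb S(H))$ is the set of strongly continuous maps $F:[0,T]\to\mathbb S(H)$, i.e. $F(\cdot)\xi$ is continuous for each $\xi\in H$. $P\in C_{\mathcal S}([0,T];\mathbb S(H))$ is a strongly regular mild solution of the Riccati equation if for every $\eta\in H$ and $s\in[0,T]$, $$P(s)\eta=S(T-s)^*GS(T-s)\eta+\int_s^TS(\tau-s)^*\big(C^*PC+M-L^*K^{-1}L\big)S(\tau-s)\eta\,d\tau,$$ and for some $c_0>0$, $K(s)\ge c_0I$ for a.e. $s\in[0,T]$, where $L(\cdot)=B(\cdot)^*P(\cdot)+D(\cdot)^*P(\cdot)C(\cdot)$ and $K(\cdot)=R(\cdot)+D(\cdot)^*P(\cdot)D(\cdot)$. *)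

theory Defs
  imports "HOL-Analysis.Analysis"
begin

text \<open>
  Hilbert spaces are types of sort \<open>{real_inner, banach}\<close>. A separable one has in addition the sort
  \<open>second_countable_topology\<close>, which for metric spaces is separability.
  Bounded operators are elements of the type of bounded linear functions, with the operator norm.
\<close>

section \<open>Bounded operators\<close>

text \<open>
  The library's \<open>adjoint\<close> acts on plain functions. On a Hilbert space the adjoint of a bounded
  operator is again bounded and linear, so \<open>Blinfun\<close> is not applied to a junk argument here.
\<close>

definition adj :: "('a::{real_inner, banach} \<Rightarrow>\<^sub>L 'b::{real_inner, banach}) \<Rightarrow> ('b \<Rightarrow>\<^sub>L 'a)" where
  "adj F = Blinfun (adjoint (blinfun_apply F))"

definition self_adjoint :: "('a::{real_inner, banach} \<Rightarrow>\<^sub>L 'a) \<Rightarrow> bool" where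
  "self_adjoint F \<longleftrightarrow> adj F = F"

text \<open>
  The inverse operator. It is meaningful for bijective \<open>F\<close> only (the inverse is then bounded); below it
  is applied to operators satisfying \<open>K \<ge> c\<^sub>0 I\<close> with \<open>c\<^sub>0 > 0\<close>, up to a null set of times.
\<close>

definition op_inv :: "('a::{real_inner, banach} \<Rightarrow>\<^sub>L 'b::{real_inner, banach}) \<Rightarrow> ('b \<Rightarrow>\<^sub>L 'a)" where
  "op_inv F = Blinfun (inv (blinfun_apply F))"

text \<open>The order \<open>F \<ge> c I\<close> for self-adjoint \<open>F\<close>.\<close>

definition op_ge_scalar :: "('a::{real_inner, banach} \<Rightarrow>\<^sub>L 'a) \<Rightarrow> real \<Rightarrow> bool" where
  "op_ge_scalar F c \<longleftrightarrow> self_adjoint F \<and> (\<forall>u. c * (norm u)\<^sup>2 \<le> F u \<bullet> u)"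

section \<open>Semigroups and generators\<close>

text \<open>Only the values \<open>S t\<close> with \<open>t \<ge> 0\<close> matter.\<close>

definition C0_semigroup :: "(real \<Rightarrow> ('a::banach \<Rightarrow>\<^sub>L 'a)) \<Rightarrow> bool" where
  "C0_semigroup S \<longleftrightarrow>
     S 0 = id_blinfun \<and>
     (\<forall>s\<ge>0. \<forall>t\<ge>0. S (s + t) = S s o\<^sub>L S t) \<and>
     (\<forall>x. ((\<lambda>t. S t x) \<longlongrightarrow> x) (at_right 0))"

text \<open>
  The (unbounded) operator \<open>A\<close> with domain \<open>domA\<close> is the infinitesimal generator of \<open>S\<close>; the values of
  the function \<open>A\<close> outside \<open>domA\<close> are irrelevant.
\<close>

definition generates_C0_semigroup ::
  "'a::banach set \<Rightarrow> ('a \<Rightarrow> 'a) \<Rightarrow> (real \<Rightarrow> ('a \<Rightarrow>\<^sub>L 'a)) \<Rightarrow> bool" where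
  "generates_C0_semigroup domA A S \<longleftrightarrow>
     C0_semigroup S \<and>
     domA = {x. \<exists>y. ((\<lambda>t. (S t x - x) /\<^sub>R t) \<longlongrightarrow> y) (at_right 0)} \<and>
     (\<forall>x\<in>domA. ((\<lambda>t. (S t x - x) /\<^sub>R t) \<longlongrightarrow> A x) (at_right 0))"

section \<open>Function spaces on \<open>(0,T)\<close>\<close>

text \<open>
  The spaces \<open>L\<^sup>\<infinity>(0,T;X)\<close> and \<open>L\<^sup>1(0,T;X)\<close> are the Bochner spaces. The library's
  \<open>borel_measurable\<close> and \<open>integrable\<close> capture Bochner measurability and integrability only for
  separable \<open>X\<close>, and spaces of operators are not separable in general; hence strong measurability is
  spelled out as being an a.e. limit of simple functions.
\<close>

definition strongly_measurable :: "'t measure \<Rightarrow> ('t \<Rightarrow> 'x::real_normed_vector) \<Rightarrow> bool" where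
  "strongly_measurable \<mu> f \<longleftrightarrow>
     (\<exists>g :: nat \<Rightarrow> 't \<Rightarrow> 'x. (\<forall>n. simple_function \<mu> (g n)) \<and>
        (AE t in \<mu>. (\<lambda>n. g n t) \<longlonglongrightarrow> f t))"

definition L_infinity :: "real \<Rightarrow> (real \<Rightarrow> 'x::real_normed_vector) set" where
  "L_infinity T = {f. strongly_measurable (lebesgue_on {0<..<T}) f \<and>
     (\<exists>c. AE t in lebesgue_on {0<..<T}. norm (f t) \<le> c)}"

definition L_one :: "real \<Rightarrow> (real \<Rightarrow> 'x::real_normed_vector) set" where
  "L_one T = {f. strongly_measurable (lebesgue_on {0<..<T}) f \<and>
     (\<integral>\<^sup>+ t. ennreal (norm (f t)) \<partial>lebesgue_on {0<..<T}) < \<infinity>}"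

text \<open>Values in \<open>\<S>(X)\<close>; as elements of Lebesgue spaces are classes of functions, a.e. self-adjointness
  is what is meant.\<close>

definition ae_self_adjoint :: "real \<Rightarrow> (real \<Rightarrow> ('a::{real_inner, banach} \<Rightarrow>\<^sub>L 'a)) \<Rightarrow> bool" where
  "ae_self_adjoint T f \<longleftrightarrow> (AE t in lebesgue_on {0<..<T}. self_adjoint (f t))"

text \<open>\<open>C\<^sub>\<S>([0,T]; \<S>(H))\<close>; values outside \<open>[0,T]\<close> are unconstrained.\<close>

definition C_strong_selfadj :: "real \<Rightarrow> (real \<Rightarrow> ('a::{real_inner, banach} \<Rightarrow>\<^sub>L 'a)) set" where
  "C_strong_selfadj T = {F. (\<forall>t\<in>{0..T}. self_adjoint (F t)) \<and>
     (\<forall>\<xi>. continuous_on {0..T} (\<lambda>t. F t \<xi>))}"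

section \<open>The Riccati equation\<close>

definition riccati_L ::
  "(real \<Rightarrow> ('u::{real_inner, banach} \<Rightarrow>\<^sub>L 'h::{real_inner, banach})) \<Rightarrow> (real \<Rightarrow> ('h \<Rightarrow>\<^sub>L 'h)) \<Rightarrow>
   (real \<Rightarrow> ('u \<Rightarrow>\<^sub>L 'h)) \<Rightarrow> (real \<Rightarrow> ('h \<Rightarrow>\<^sub>L 'h)) \<Rightarrow> real \<Rightarrow> ('h \<Rightarrow>\<^sub>L 'u)" where
  "riccati_L B C D P s = (adj (B s) o\<^sub>L P s) + (adj (D s) o\<^sub>L P s o\<^sub>L C s)"

definition riccati_K ::
  "(real \<Rightarrow> ('u::{real_inner, banach} \<Rightarrow>\<^sub>L 'h::{real_inner, banach})) \<Rightarrow> (real \<Rightarrow> ('u \<Rightarrow>\<^sub>L 'u)) \<Rightarrow>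
   (real \<Rightarrow> ('h \<Rightarrow>\<^sub>L 'h)) \<Rightarrow> real \<Rightarrow> ('u \<Rightarrow>\<^sub>L 'u)" where
  "riccati_K D R P s = R s + (adj (D s) o\<^sub>L P s o\<^sub>L D s)"

definition riccati_nonlinearity ::
  "(real \<Rightarrow> ('u::{real_inner, banach} \<Rightarrow>\<^sub>L 'h::{real_inner, banach})) \<Rightarrow> (real \<Rightarrow> ('h \<Rightarrow>\<^sub>L 'h)) \<Rightarrow>
   (real \<Rightarrow> ('u \<Rightarrow>\<^sub>L 'h)) \<Rightarrow> (real \<Rightarrow> ('h \<Rightarrow>\<^sub>L 'h)) \<Rightarrow> (real \<Rightarrow> ('u \<Rightarrow>\<^sub>L 'u)) \<Rightarrow>
   (real \<Rightarrow> ('h \<Rightarrow>\<^sub>L 'h)) \<Rightarrow> real \<Rightarrow> ('h \<Rightarrow>\<^sub>L 'h)" where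
  "riccati_nonlinearity B C D M R P s =
     (adj (C s) o\<^sub>L P s o\<^sub>L C s) + M s
       - (adj (riccati_L B C D P s) o\<^sub>L op_inv (riccati_K D R P s) o\<^sub>L riccati_L B C D P s)"

text \<open>
  \<open>has_bochner_integral\<close> expresses that the Bochner integral over \<open>[s,T]\<close> exists in \<open>H\<close> and equals
  \<open>P(s)\<eta> - S(T-s)\<^sup>* G S(T-s)\<eta>\<close>. The operator \<open>A\<close> enters only through the semigroup \<open>S\<close> it generates.
\<close>

definition strongly_regular_mild_solution ::
  "real \<Rightarrow> (real \<Rightarrow> ('h::{real_inner, banach, second_countable_topology} \<Rightarrow>\<^sub>L 'h)) \<Rightarrow>
   (real \<Rightarrow> ('u::{real_inner, banach} \<Rightarrow>\<^sub>L 'h)) \<Rightarrow> (real \<Rightarrow> ('h \<Rightarrow>\<^sub>L 'h)) \<Rightarrow>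
   (real \<Rightarrow> ('u \<Rightarrow>\<^sub>L 'h)) \<Rightarrow> ('h \<Rightarrow>\<^sub>L 'h) \<Rightarrow> (real \<Rightarrow> ('h \<Rightarrow>\<^sub>L 'h)) \<Rightarrow>
   (real \<Rightarrow> ('u \<Rightarrow>\<^sub>L 'u)) \<Rightarrow> (real \<Rightarrow> ('h \<Rightarrow>\<^sub>L 'h)) \<Rightarrow> bool" where
  "strongly_regular_mild_solution T S B C D G M R P \<longleftrightarrow>
     P \<in> C_strong_selfadj T \<and>
     (\<forall>\<eta>. \<forall>s\<in>{0..T}.
        has_bochner_integral (lebesgue_on {s..T})
          (\<lambda>\<tau>. (adj (S (\<tau> - s)) o\<^sub>L riccati_nonlinearity B C D M R P \<tau> o\<^sub>L S (\<tau> - s)) \<eta>)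
          (P s \<eta> - (adj (S (T - s)) o\<^sub>L G o\<^sub>L S (T - s)) \<eta>)) \<and>
     (\<exists>c\<^sub>0>0. AE s in lebesgue_on {0..T}. op_ge_scalar (riccati_K D R P s) c\<^sub>0)"

end

theory Submission
  imports Defs
begin

text \<open>
  Let \<open>\<Delta>\<close> be the difference of two solutions. In the difference of the two mild equations the terminal
  value \<open>G\<close> and the inhomogeneity \<open>M\<close> cancel, and
  \[ \Delta(s)\eta = \int_s^T S(\tau-s)^* \big(N(P_1) - N(P_2)\big)(\tau)\, S(\tau-s)\eta \, d\tau, \]
  where \<open>N(P) = C\<^sup>*PC + M - L\<^sup>*K\<^sup>-\<^sup>1L\<close>. The nonlinearity \<open>N\<close> is locally Lipschitz in \<open>P\<close>, uniformly in
  time, as soon as the coefficients and the solutions are bounded and \<open>K\<close> stays uniformly coercive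
  (\<open>riccati_nonlinearity_lipschitz\<close>): \<open>L\<close> and \<open>K\<close> are affine in \<open>P\<close>, and inversion is Lipschitz on the
  operators that are bounded below by a fixed positive constant. Since the semigroup is bounded on
  \<open>[0,T]\<close>, a Gronwall argument backwards from \<open>T\<close> gives \<open>\<Delta> = 0\<close>.

  The argument rests on two pillars. Strong continuity gives bounds in operator norm, for
  the solutions and for the semigroup, only through the uniform boundedness principle
  (\<open>uniform_boundedness\<close>). The operations \<open>adj\<close> and \<open>op_inv\<close> have their meaning only through two
  existence theorems for Hilbert spaces: the Riesz representation theorem, and the invertibility of
  coercive self-adjoint operators. Both are instances of one variational statement
  (\<open>coercive_form_represents\<close>).

  One point needs care: \<open>P\<^sub>1\<close> and \<open>P\<^sub>2\<close> are only strongly continuous, so \<open>\<parallel>\<Delta>(\<tau>)\<parallel>\<close> need not be continuous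
  in \<open>\<tau>\<close>. The Gronwall lemma therefore only ever integrates continuous majorants of this function
  (\<open>backward_gronwall_zero\<close>).
\<close>

section \<open>Uniform boundedness\<close>

text \<open>
  The closed sets on which the whole family is bounded by \<open>n\<close> cover the space, so by Baire one of them
  contains a ball around some \<open>x\<close>. Differences of points of that ball reach all directions, which turns
  the bound on the ball into a bound on the operator norms.
\<close>

lemma uniform_boundedness:
  fixes f :: "'i \<Rightarrow> 'a::banach \<Rightarrow>\<^sub>L 'b::real_normed_vector"
  assumes pointwise: "\<And>x. \<exists>k. \<forall>i\<in>I. norm (f i x) \<le> k"
  shows "\<exists>k. \<forall>i\<in>I. norm (f i) \<le> k"
proof -
  define F where "F n = {x. \<forall>i\<in>I. norm (f i x) \<le> real n}" for n :: nat
  have closed_F: "closed (F n)" for n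
  proof -
    have "F n = (\<Inter>i\<in>I. {x. norm (f i x) \<le> real n})"
      by (auto simp: F_def)
    then show ?thesis
      by (auto intro!: closed_INT closed_Collect_le continuous_intros)
  qed
  have "x \<in> (\<Union>n. F n)" for x
  proof -
    obtain k where "\<forall>i\<in>I. norm (f i x) \<le> k" using pointwise by blast
    moreover obtain n where "k \<le> real n" using real_arch_simple by blast
    ultimately have "x \<in> F n" unfolding F_def by fastforce
    then show ?thesis by blast
  qed
  then have cover: "(\<Union>n. F n) = UNIV" by blast
  have "\<exists>n. interior (F n) \<noteq> {}"
  proof (rule ccontr)
    assume "\<not> ?thesis"
    then have "interior (\<Union>(range F)) = {}"
      using Met_TC.metric_Baire_category_alt[of "range F"] closed_F complete_UNIV by force
    then show False using cover by simp
  qed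
  then obtain n x r where r: "r > 0" and ball: "cball x r \<subseteq> F n"
    by (meson ex_in_conv mem_interior_cball)
  have "norm (f i) \<le> 2 * real n / r" if i: "i \<in> I" for i
  proof (rule norm_blinfun_bound)
    show "0 \<le> 2 * real n / r" using r by simp
    fix y
    show "norm (f i y) \<le> 2 * real n / r * norm y"
    proof (cases "y = 0")
      case False
      define z where "z = (r / norm y) *\<^sub>R y"
      have "x + z \<in> F n" "x \<in> F n"
        using ball r False by (auto simp: z_def dist_norm subset_iff)
      then have le: "norm (f i (x + z)) \<le> real n" "norm (f i x) \<le> real n"
        using i by (auto simp: F_def)
      have "norm (f i z) = norm (f i (x + z) - f i x)"
        by (simp add: blinfun.add_right)
      also have "\<dots> \<le> 2 * real n"
        using norm_triangle_ineq4[of "f i (x + z)" "f i x"] le by linarith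
      finally have "r / norm y * norm (f i y) \<le> 2 * real n"
        using r by (simp add: z_def blinfun.scaleR_right)
      then show ?thesis using r False by (simp add: field_simps)
    qed (simp add: blinfun.zero_right)
  qed
  then show ?thesis by blast
qed

lemma C_strong_selfadj_bounded:
  assumes "P \<in> C_strong_selfadj T"
  shows "\<exists>k. \<forall>t\<in>{0..T}. norm (P t) \<le> k"
proof (rule uniform_boundedness)
  fix x
  have "compact ((\<lambda>t. P t x) ` {0..T})"
    using assms by (intro compact_continuous_image) (auto simp: C_strong_selfadj_def)
  then show "\<exists>k. \<forall>t\<in>{0..T}. norm (P t x) \<le> k"
    using compact_imp_bounded bounded_iff by (metis imageI)
qed

text \<open>
  Were \<open>\<parallel>S t\<parallel>\<close> unbounded near 0, it would be unbounded along some sequence \<open>t\<^sub>n \<rightarrow> 0\<close>. But each orbit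
  \<open>S t\<^sub>n x\<close> converges to \<open>x\<close>, hence is bounded, which the uniform boundedness principle forbids. Passing
  to sequences matters: strong continuity at 0 bounds an orbit on an interval depending on \<open>x\<close>.
\<close>

lemma C0_semigroup_bounded_near_0:
  fixes S :: "real \<Rightarrow> ('a::banach \<Rightarrow>\<^sub>L 'a)"
  assumes S: "C0_semigroup S"
  shows "\<exists>\<delta>>0. \<exists>k. \<forall>t\<in>{0..\<delta>}. norm (S t) \<le> k"
proof (rule ccontr)
  assume contra: "\<not> ?thesis"
  have "\<exists>t. 0 < t \<and> t \<le> 1 / real (Suc n) \<and> norm (S t) > real (Suc n)" for n
  proof -
    have "\<not> (\<forall>t\<in>{0..1 / real (Suc n)}. norm (S t) \<le> real (Suc n))"
      using contra by (meson divide_pos_pos of_nat_0_less_iff zero_less_Suc zero_less_one)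
    then obtain t where t: "0 \<le> t" "t \<le> 1 / real (Suc n)" "norm (S t) > real (Suc n)"
      by (auto simp: not_le)
    have "norm (S 0) \<le> 1"
      using S norm_blinfun_id_le by (simp add: C0_semigroup_def)
    then have "t \<noteq> 0" using t by auto
    then have "0 < t" using t by simp
    with t show ?thesis by blast
  qed
  then obtain t where t: "\<And>n. 0 < t n" "\<And>n. t n \<le> 1 / real (Suc n)"
      "\<And>n. norm (S (t n)) > real (Suc n)" by metis
  have "(\<lambda>n. 1 / real (Suc n)) \<longlonglongrightarrow> 0"
    using LIMSEQ_inverse_real_of_nat by (simp add: inverse_eq_divide)
  then have "t \<longlonglongrightarrow> 0"
    by (rule tendsto_sandwich[OF _ _ tendsto_const, rotated 2])
      (use t in \<open>auto simp: less_imp_le\<close>)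
  then have t0: "filterlim t (at_right 0) sequentially"
    by (rule tendsto_imp_filterlim_at_right) (simp add: t(1))
  have "\<exists>k. \<forall>n\<in>UNIV. norm (S (t n) x) \<le> k" for x
  proof -
    have "((\<lambda>t. S t x) \<longlongrightarrow> x) (at_right 0)"
      using S by (simp add: C0_semigroup_def)
    then have "(\<lambda>n. S (t n) x) \<longlonglongrightarrow> x"
      using t0 by (rule filterlim_compose)
    then show ?thesis
      using convergent_imp_bounded bounded_iff by (metis rangeI)
  qed
  then obtain k where k: "\<And>n. norm (S (t n)) \<le> k"
    using uniform_boundedness[of UNIV "\<lambda>n. S (t n)"] by auto
  obtain n where "k \<le> real n" using real_arch_simple by blast
  then show False using k[of n] t(3)[of n] by simp
qed

text \<open>The semigroup law carries the bound near 0 over to compact intervals, one step of length \<open>\<delta>\<close> at a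
  time.\<close>

lemma C0_semigroup_bounded:
  fixes S :: "real \<Rightarrow> ('a::banach \<Rightarrow>\<^sub>L 'a)"
  assumes S: "C0_semigroup S"
  shows "\<exists>k. \<forall>t\<in>{0..T}. norm (S t) \<le> k"
proof -
  obtain \<delta> k where \<delta>: "\<delta> > 0" and k: "\<And>t. 0 \<le> t \<Longrightarrow> t \<le> \<delta> \<Longrightarrow> norm (S t) \<le> k"
    using C0_semigroup_bounded_near_0[OF S] by (metis atLeastAtMost_iff)
  have k0: "0 \<le> k" using k[of 0] \<delta> norm_ge_zero[of "S 0"] by linarith
  have "\<exists>m. \<forall>t\<in>{0..real n * \<delta>}. norm (S t) \<le> m" for n
  proof (induction n)
    case 0
    then show ?case by auto
  next
    case (Suc n)
    then obtain m where m: "\<And>t. 0 \<le> t \<Longrightarrow> t \<le> real n * \<delta> \<Longrightarrow> norm (S t) \<le> m" by (metis atLeastAtMost_iff)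
    have m0: "0 \<le> m" using m[of 0] \<delta> norm_ge_zero[of "S 0"] by (meson mult_nonneg_nonneg of_nat_0_le_iff order_refl less_imp_le order_trans)
    have "norm (S t) \<le> max k (k * m)" if t: "t \<in> {0..real (Suc n) * \<delta>}" for t
    proof (cases "t \<le> \<delta>")
      case True
      then show ?thesis using k[of t] t by auto
    next
      case False
      have "S (\<delta> + (t - \<delta>)) = S \<delta> o\<^sub>L S (t - \<delta>)"
        using S \<delta> False unfolding C0_semigroup_def by (metis diff_ge_0_iff_ge less_imp_le not_le)
      then have "norm (S t) \<le> norm (S \<delta>) * norm (S (t - \<delta>))"
        using norm_blinfun_compose[of "S \<delta>" "S (t - \<delta>)"] by simp
      also have "\<dots> \<le> k * m"
        using t False \<delta> k0 by (intro mult_mono k m) (auto simp: algebra_simps)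
      finally show ?thesis by simp
    qed
    then show ?case by blast
  qed
  moreover obtain n where "T / \<delta> \<le> real n" using real_arch_simple by blast
  then have "T \<le> real n * \<delta>" using \<delta> by (simp add: field_simps)
  ultimately show ?thesis by (meson atLeastAtMost_iff order_trans)
qed

section \<open>Adjoints and inverses of coercive operators\<close>

text \<open>
  The Lax-Milgram theorem for symmetric forms. The solution minimises the energy
  \<open>J u = a u u - 2 \<phi> u\<close>, which is bounded below by coercivity. The parallelogram law for \<open>a\<close>, together
  with coercivity, makes minimising sequences Cauchy, and \<open>a u w = \<phi> w\<close> is the Euler-Lagrange equation
  at the minimiser. With \<open>a\<close> the inner product this is the Riesz representation theorem; with
  \<open>a u w = F u \<bullet> w\<close> it is the surjectivity of a coercive self-adjoint operator \<open>F\<close>.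
\<close>

lemma coercive_form_represents:
  fixes a :: "'a::banach \<Rightarrow> 'a \<Rightarrow> real"
  assumes a: "bounded_bilinear a" and sym: "\<And>x y. a x y = a y x"
    and c: "c > 0" and coercive: "\<And>x. c * (norm x)\<^sup>2 \<le> a x x"
    and \<phi>: "bounded_linear \<phi>"
  shows "\<exists>u. \<forall>w. a u w = \<phi> w"
proof -
  interpret a: bounded_bilinear a by (rule a)
  interpret \<phi>: bounded_linear \<phi> by (rule \<phi>)
  define J where "J u = a u u - 2 * \<phi> u" for u
  obtain k where k: "\<And>x. norm (\<phi> x) \<le> norm x * k" using \<phi>.bounded by blast
  have "- k\<^sup>2 / c \<le> J u" for u
  proof -
    have "0 \<le> (c * norm u - k)\<^sup>2 / c" using c by simp
    also have "\<dots> = c * (norm u)\<^sup>2 - 2 * (norm u * k) + k\<^sup>2 / c"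
      using c by (simp add: field_simps power2_eq_square)
    finally show ?thesis using coercive[of u] k[of u] by (simp add: J_def)
  qed
  then have bdd: "bdd_below (range J)" by (auto simp: bdd_below_def)
  define m where "m = Inf (range J)"
  have m: "m \<le> J u" for u unfolding m_def using bdd by (simp add: cInf_lower)
  have par: "J u + J v - 2 * J ((1/2) *\<^sub>R (u + v)) = a (u - v) (u - v) / 2" for u v
    by (simp add: J_def a.add_left a.add_right a.diff_left a.diff_right a.scaleR_left
        a.scaleR_right \<phi>.add \<phi>.scaleR sym[of v u] field_simps)
  have close: "c * (norm (u - v))\<^sup>2 \<le> 2 * (J u + J v - 2 * m)" for u v
    using par[of u v] coercive[of "u - v"] m[of "(1/2) *\<^sub>R (u + v)"] by argo
  have "\<exists>u. J u < m + 1 / real (Suc n)" for n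
  proof -
    have "Inf (range J) < m + 1 / real (Suc n)" by (simp add: m_def)
    then show ?thesis using cInf_lessD[of "range J"] by blast
  qed
  then obtain u where u: "\<And>n. J (u n) < m + 1 / real (Suc n)" by metis
  have "Cauchy u"
  proof (rule metric_CauchyI)
    fix e :: real
    assume e: "e > 0"
    obtain N where N: "4 / (c * e\<^sup>2) < real N" using reals_Archimedean2 by blast
    have "dist (u i) (u j) < e" if "i \<ge> N" "j \<ge> N" for i j
    proof -
      have *: "1 / real (Suc i) < c * e\<^sup>2 / 4" if "i \<ge> N" for i
      proof -
        have "4 / (c * e\<^sup>2) < real (Suc i)" using N that by simp
        then show ?thesis using c e by (simp add: field_simps)
      qed
      have "c * (norm (u i - u j))\<^sup>2 < c * e\<^sup>2"
        using close[of "u i" "u j"] u[of i] u[of j] *[OF that(1)] *[OF that(2)]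
        by argo
      then have "norm (u i - u j) < e"
        using c e by (simp add: power_less_imp_less_base)
      then show ?thesis by (simp add: dist_norm)
    qed
    then show "\<exists>N. \<forall>i\<ge>N. \<forall>j\<ge>N. dist (u i) (u j) < e" by blast
  qed
  then obtain v where v: "u \<longlonglongrightarrow> v" using Cauchy_convergent convergentD by blast
  have "(\<lambda>n. J (u n)) \<longlonglongrightarrow> J v"
    unfolding J_def by (intro tendsto_intros a.tendsto \<phi>.tendsto v)
  moreover have "(\<lambda>n. m + 1 / real (Suc n)) \<longlonglongrightarrow> m + 0"
    using LIMSEQ_inverse_real_of_nat by (intro tendsto_add tendsto_const) (simp add: inverse_eq_divide)
  ultimately have Jv: "J v \<le> m"
    using LIMSEQ_le u by (metis (mono_tags, lifting) add.right_neutral less_imp_le)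
  have "a v w = \<phi> w" for w
  proof -
    define b where "b = a v w - \<phi> w"
    define d where "d = a w w"
    have d: "0 \<le> d" using coercive[of w] c by (simp add: d_def order_trans[rotated])
    \<comment> \<open>Up to the factor \<open>d / (d + 1)\<close> this is the minimum point of the quadratic \<open>2 t b + t\<^sup>2 d\<close>; the
      denominator \<open>d + 1\<close> makes it meaningful also for \<open>w = 0\<close>.\<close>
    define t where "t = - b / (d + 1)"
    have "J (v + t *\<^sub>R w) = J v + 2 * t * b + t\<^sup>2 * d"
      by (simp add: J_def b_def d_def a.add_left a.add_right a.scaleR_left a.scaleR_right
          \<phi>.add \<phi>.scaleR sym[of w v] algebra_simps power2_eq_square)
    then have "0 \<le> 2 * t * b + t\<^sup>2 * d" using m[of "v + t *\<^sub>R w"] Jv by linarith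
    also have "\<dots> = - (b / (d + 1))\<^sup>2 * (d + 2)"
      using d by (simp add: t_def divide_simps) (simp add: algebra_simps power2_eq_square)
    finally have "(b / (d + 1))\<^sup>2 * (d + 2) \<le> 0" by simp
    then have "b = 0" using d by (simp add: mult_le_0_iff)
    then show ?thesis by (simp add: b_def)
  qed
  then show ?thesis by blast
qed

lemma blinfun_adjoint_exists:
  fixes F :: "'a::{real_inner, banach} \<Rightarrow>\<^sub>L 'b::{real_inner, banach}"
  shows "\<exists>F'. \<forall>x y. F x \<bullet> y = x \<bullet> F' y"
proof -
  have "\<exists>u. \<forall>x. u \<bullet> x = F x \<bullet> y" for y
  proof (rule coercive_form_represents[OF bounded_bilinear_inner inner_commute zero_less_one])
    show "bounded_linear (\<lambda>x. F x \<bullet> y)"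
      by (intro bounded_linear_intros blinfun.bounded_linear_right)
  qed (simp add: power2_norm_eq_inner)
  then show ?thesis by (metis inner_commute)
qed

lemma norm_adjoint_le:
  fixes F :: "'a::real_inner \<Rightarrow>\<^sub>L 'b::real_inner"
  assumes "\<And>x y. F x \<bullet> y = x \<bullet> F' y"
  shows "norm (F' y) \<le> norm F * norm y"
proof (cases "F' y = 0")
  case False
  have "(norm (F' y))\<^sup>2 = F (F' y) \<bullet> y" by (simp add: assms power2_norm_eq_inner)
  also have "\<dots> \<le> norm F * norm (F' y) * norm y"
    by (meson norm_blinfun norm_cauchy_schwarz norm_ge_zero mult_right_mono order_trans)
  finally show ?thesis using False by (simp add: power2_eq_square mult.commute mult.left_commute)
qed simp

text \<open>
  The choice and the \<open>Blinfun\<close> in the definition of \<open>adj\<close> are harmless: some function satisfies the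
  adjoint equation, and any such function is bounded and linear.
\<close>

lemma adj_apply:
  fixes F :: "'a::{real_inner, banach} \<Rightarrow>\<^sub>L 'b::{real_inner, banach}"
  shows "x \<bullet> adj F y = F x \<bullet> y"
proof -
  obtain F' where F': "\<forall>x y. F x \<bullet> y = x \<bullet> F' y" using blinfun_adjoint_exists by blast
  have "bounded_linear F'"
  proof (rule bounded_linear_intro)
    show "F' (x + y) = F' x + F' y" for x y
      by (rule vector_eq_ldot[THEN iffD1]) (simp add: inner_add_right F'[rule_format, symmetric])
    show "F' (r *\<^sub>R x) = r *\<^sub>R F' x" for r x
      by (rule vector_eq_ldot[THEN iffD1]) (simp add: F'[rule_format, symmetric])
    show "norm (F' y) \<le> norm y * norm F" for y
      using norm_adjoint_le F' by (metis mult.commute)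
  qed
  then have "blinfun_apply (adj F) = F'"
    unfolding adj_def adjoint_unique[OF F'] by (rule bounded_linear_Blinfun_apply)
  then show ?thesis using F' by simp
qed

lemma adj_diff: "adj (F - G) = adj F - adj G"
  by (rule blinfun_eqI, rule vector_eq_ldot[THEN iffD1])
    (simp add: adj_apply blinfun.diff_left inner_diff_left inner_diff_right)

lemma norm_adj_le: "norm (adj F) \<le> norm F"
  by (rule norm_blinfun_bound) (simp_all add: norm_adjoint_le adj_apply)

lemma op_ge_scalar_mono: "op_ge_scalar F c \<Longrightarrow> d \<le> c \<Longrightarrow> op_ge_scalar F d"
  unfolding op_ge_scalar_def
  by (blast intro: order_trans[OF mult_right_mono[OF _ zero_le_power2]])

text \<open>
  Coercivity gives \<open>c \<parallel>u\<parallel> \<le> \<parallel>F u\<parallel>\<close> by Cauchy-Schwarz, so \<open>F\<close> is injective and its inverse is bounded by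
  \<open>1 / c\<close>; surjectivity is \<open>coercive_form_represents\<close>.
\<close>

lemma
  fixes F :: "'a::{real_inner, banach} \<Rightarrow>\<^sub>L 'a"
  assumes F: "op_ge_scalar F c" and c: "c > 0"
  shows op_inv_right: "F (op_inv F x) = x"
    and op_inv_left: "op_inv F (F x) = x"
    and norm_op_inv_le: "norm (op_inv F) \<le> 1 / c"
proof -
  have coercive: "c * (norm u)\<^sup>2 \<le> F u \<bullet> u" for u using F by (simp add: op_ge_scalar_def)
  have sym: "F x \<bullet> y = F y \<bullet> x" for x y
    using F adj_apply[of x F y] by (simp add: op_ge_scalar_def self_adjoint_def inner_commute)
  have expand: "c * norm u \<le> norm (F u)" for u
  proof (cases "u = 0")
    case False
    have "c * norm u * norm u \<le> norm (F u) * norm u"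
      using coercive[of u] norm_cauchy_schwarz[of "F u" u] by (simp add: power2_eq_square mult.assoc)
    then show ?thesis using False by simp
  qed simp
  have "inj F"
  proof (rule injI)
    fix x y assume "F x = F y"
    then have "c * norm (x - y) \<le> 0" using expand[of "x - y"] by (simp add: blinfun.diff_right)
    then show "x = y" using c by (simp add: mult_le_0_iff)
  qed
  have "\<exists>u. F u = v" for v
  proof -
    have "\<exists>u. \<forall>w. F u \<bullet> w = v \<bullet> w"
    proof (rule coercive_form_represents[where a = "\<lambda>u w. F u \<bullet> w", OF _ sym c coercive])
      show "bounded_bilinear (\<lambda>u w. F u \<bullet> w)"
        by (rule bounded_bilinear.comp1[OF bounded_bilinear_inner blinfun.bounded_linear_right])
      show "bounded_linear (\<lambda>w. v \<bullet> w)" by (rule bounded_linear_inner_right)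
    qed
    then show ?thesis by (simp add: vector_eq_rdot)
  qed
  then have "surj F" by (metis surjI)
  then have right: "F (inv F x) = x" for x by (rule surj_f_inv_f)
  have bound: "norm (inv F x) \<le> norm x * (1 / c)" for x
    using expand[of "inv F x"] c by (simp add: right field_simps)
  have "bounded_linear (inv F)"
  proof (rule bounded_linear_intro[OF _ _ bound])
    show "inv F (x + y) = inv F x + inv F y" for x y
      using \<open>inj F\<close> by (rule injD) (simp add: right blinfun.add_right)
    show "inv F (r *\<^sub>R x) = r *\<^sub>R inv F x" for r x
      using \<open>inj F\<close> by (rule injD) (simp add: right blinfun.scaleR_right)
  qed
  then have op_inv: "blinfun_apply (op_inv F) = inv F"
    unfolding op_inv_def by (rule bounded_linear_Blinfun_apply)
  show "F (op_inv F x) = x" by (simp add: op_inv right)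
  show "op_inv F (F x) = x" using \<open>inj F\<close> by (simp add: op_inv)
  show "norm (op_inv F) \<le> 1 / c"
    using bound c by (intro norm_blinfun_bound) (auto simp: op_inv mult.commute)
qed

section \<open>Lipschitz dependence of the nonlinearity\<close>

lemma norm_compose_le:
  assumes "norm F \<le> a" "norm G \<le> b"
  shows "norm (F o\<^sub>L G) \<le> a * b"
proof -
  have "0 \<le> a" using assms(1) norm_ge_zero[of F] by linarith
  then have "norm F * norm G \<le> a * b" using assms by (intro mult_mono) auto
  then show ?thesis by (rule order_trans[OF norm_blinfun_compose])
qed

text \<open>The resolvent identity \<open>F\<^sup>-\<^sup>1 - G\<^sup>-\<^sup>1 = F\<^sup>-\<^sup>1 (G - F) G\<^sup>-\<^sup>1\<close>.\<close>

lemma op_inv_lipschitz: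
  assumes F: "op_ge_scalar F c" and G: "op_ge_scalar G c" and c: "c > 0"
  shows "norm (op_inv F - op_inv G) \<le> norm (F - G) / c\<^sup>2"
proof -
  have "op_inv F - op_inv G = op_inv F o\<^sub>L (G - F) o\<^sub>L op_inv G"
    by (intro blinfun_eqI)
      (simp add: blinfun.diff_left blinfun.diff_right op_inv_left[OF F c] op_inv_right[OF G c])
  also have "norm \<dots> \<le> 1 / c * norm (G - F) * (1 / c)"
    by (intro norm_compose_le norm_op_inv_le[OF F c] norm_op_inv_le[OF G c] order_refl)
  finally show ?thesis by (simp add: power2_eq_square norm_minus_commute)
qed

text \<open>The product rule for \<open>L\<^sup>*JL\<close>: the difference telescopes into three terms, each containing only one
  of the differences \<open>L\<^sub>1 - L\<^sub>2\<close> and \<open>J\<^sub>1 - J\<^sub>2\<close>.\<close>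

lemma norm_triple_diff_le:
  fixes L\<^sub>1 L\<^sub>2 :: "'a::{real_inner, banach} \<Rightarrow>\<^sub>L 'b::{real_inner, banach}"
  assumes "norm L\<^sub>1 \<le> l" "norm L\<^sub>2 \<le> l" "norm J\<^sub>1 \<le> j" "norm J\<^sub>2 \<le> j"
    and "norm (L\<^sub>1 - L\<^sub>2) \<le> \<epsilon>" "norm (J\<^sub>1 - J\<^sub>2) \<le> \<delta>"
  shows "norm ((adj L\<^sub>1 o\<^sub>L J\<^sub>1 o\<^sub>L L\<^sub>1) - (adj L\<^sub>2 o\<^sub>L J\<^sub>2 o\<^sub>L L\<^sub>2)) \<le> 2 * l * j * \<epsilon> + l\<^sup>2 * \<delta>"
proof -
  have "(adj L\<^sub>1 o\<^sub>L J\<^sub>1 o\<^sub>L L\<^sub>1) - (adj L\<^sub>2 o\<^sub>L J\<^sub>2 o\<^sub>L L\<^sub>2) =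
      (adj (L\<^sub>1 - L\<^sub>2) o\<^sub>L J\<^sub>1 o\<^sub>L L\<^sub>1) + (adj L\<^sub>2 o\<^sub>L (J\<^sub>1 - J\<^sub>2) o\<^sub>L L\<^sub>1) + (adj L\<^sub>2 o\<^sub>L J\<^sub>2 o\<^sub>L (L\<^sub>1 - L\<^sub>2))"
    by (intro blinfun_eqI) (simp add: adj_diff blinfun.bilinear_simps)
  moreover have "norm (adj (L\<^sub>1 - L\<^sub>2) o\<^sub>L J\<^sub>1 o\<^sub>L L\<^sub>1) \<le> \<epsilon> * j * l"
    "norm (adj L\<^sub>2 o\<^sub>L (J\<^sub>1 - J\<^sub>2) o\<^sub>L L\<^sub>1) \<le> l * \<delta> * l"
    "norm (adj L\<^sub>2 o\<^sub>L J\<^sub>2 o\<^sub>L (L\<^sub>1 - L\<^sub>2)) \<le> l * j * \<epsilon>"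
    using assms by (auto intro!: norm_compose_le intro: order_trans[OF norm_adj_le])
  ultimately have "norm ((adj L\<^sub>1 o\<^sub>L J\<^sub>1 o\<^sub>L L\<^sub>1) - (adj L\<^sub>2 o\<^sub>L J\<^sub>2 o\<^sub>L L\<^sub>2))
      \<le> \<epsilon> * j * l + l * \<delta> * l + l * j * \<epsilon>"
    by (metis (no_types, lifting) add_mono norm_triangle_le)
  then show ?thesis by (simp add: algebra_simps power2_eq_square)
qed

text \<open>
  A pointwise estimate at a fixed time, with a constant that depends only on the bounds \<open>\<beta>\<close>, \<open>p\<close> and
  \<open>c\<close>, so that it is uniform in time. Here \<open>b = \<beta> + \<beta>\<^sup>2\<close> is the norm bound for the linear map
  \<open>Q \<mapsto> B\<^sup>*Q + D\<^sup>*QC\<close>, so \<open>\<parallel>L\<parallel> \<le> b p\<close>. The three summands of the constant come from \<open>C\<^sup>*PC\<close>, from varying \<open>L\<close>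
  and from varying \<open>K\<^sup>-\<^sup>1\<close>; the operators \<open>M\<close> and \<open>R\<close> drop out of the differences.
\<close>

lemma riccati_nonlinearity_lipschitz:
  fixes B D :: "real \<Rightarrow> ('u::{real_inner, banach} \<Rightarrow>\<^sub>L 'h::{real_inner, banach})"
  assumes B: "norm (B s) \<le> \<beta>" and C: "norm (C s) \<le> \<beta>" and D: "norm (D s) \<le> \<beta>"
    and P: "norm (P\<^sub>1 s) \<le> p" "norm (P\<^sub>2 s) \<le> p"
    and K: "op_ge_scalar (riccati_K D R P\<^sub>1 s) c" "op_ge_scalar (riccati_K D R P\<^sub>2 s) c"
    and c: "c > 0"
  defines "b \<equiv> \<beta> + \<beta>\<^sup>2"
  shows "norm (riccati_nonlinearity B C D M R P\<^sub>1 s - riccati_nonlinearity B C D M R P\<^sub>2 s)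
    \<le> (\<beta>\<^sup>2 + 2 * b\<^sup>2 * p / c + (b * p * \<beta> / c)\<^sup>2) * norm (P\<^sub>1 s - P\<^sub>2 s)"
proof -
  let ?\<Delta> = "P\<^sub>1 s - P\<^sub>2 s"
  let ?L\<^sub>1 = "riccati_L B C D P\<^sub>1 s" and ?L\<^sub>2 = "riccati_L B C D P\<^sub>2 s"
  let ?K\<^sub>1 = "riccati_K D R P\<^sub>1 s" and ?K\<^sub>2 = "riccati_K D R P\<^sub>2 s"
  have adj_B: "norm (adj (B s)) \<le> \<beta>" and adj_C: "norm (adj (C s)) \<le> \<beta>"
    and adj_D: "norm (adj (D s)) \<le> \<beta>"
    using B C D norm_adj_le[of "B s"] norm_adj_le[of "C s"] norm_adj_le[of "D s"] by linarith+
  have sum_le: "norm ((adj (B s) o\<^sub>L Q) + (adj (D s) o\<^sub>L Q o\<^sub>L C s)) \<le> b * q" if "norm Q \<le> q" for Q q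
  proof -
    have "norm ((adj (B s) o\<^sub>L Q) + (adj (D s) o\<^sub>L Q o\<^sub>L C s)) \<le> \<beta> * q + \<beta> * q * \<beta>"
      by (intro norm_triangle_le add_mono norm_compose_le adj_B adj_D C that)
    then show ?thesis by (simp add: b_def algebra_simps power2_eq_square)
  qed
  have L: "norm ?L\<^sub>1 \<le> b * p" "norm ?L\<^sub>2 \<le> b * p"
    using P by (auto simp: riccati_L_def intro: sum_le)
  have "?L\<^sub>1 - ?L\<^sub>2 = (adj (B s) o\<^sub>L ?\<Delta>) + (adj (D s) o\<^sub>L ?\<Delta> o\<^sub>L C s)"
    by (intro blinfun_eqI) (simp add: riccati_L_def blinfun.bilinear_simps)
  then have L_diff: "norm (?L\<^sub>1 - ?L\<^sub>2) \<le> b * norm ?\<Delta>" using sum_le[of ?\<Delta>] by simp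
  have "?K\<^sub>1 - ?K\<^sub>2 = adj (D s) o\<^sub>L ?\<Delta> o\<^sub>L D s"
    by (intro blinfun_eqI) (simp add: riccati_K_def blinfun.bilinear_simps)
  also have "norm \<dots> \<le> \<beta> * norm ?\<Delta> * \<beta>"
    by (intro norm_compose_le adj_D D order_refl)
  finally have "norm (op_inv ?K\<^sub>1 - op_inv ?K\<^sub>2) \<le> \<beta> * norm ?\<Delta> * \<beta> / c\<^sup>2"
    using op_inv_lipschitz[OF K c] by (meson divide_right_mono order_trans zero_le_power2)
  note quad = norm_triple_diff_le[OF L norm_op_inv_le[OF K(1) c] norm_op_inv_le[OF K(2) c] L_diff this]
  have lin: "norm (adj (C s) o\<^sub>L ?\<Delta> o\<^sub>L C s) \<le> \<beta> * norm ?\<Delta> * \<beta>"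
    by (intro norm_compose_le adj_C C order_refl)
  have "riccati_nonlinearity B C D M R P\<^sub>1 s - riccati_nonlinearity B C D M R P\<^sub>2 s =
      (adj (C s) o\<^sub>L ?\<Delta> o\<^sub>L C s)
      - ((adj ?L\<^sub>1 o\<^sub>L op_inv ?K\<^sub>1 o\<^sub>L ?L\<^sub>1) - (adj ?L\<^sub>2 o\<^sub>L op_inv ?K\<^sub>2 o\<^sub>L ?L\<^sub>2))"
    by (intro blinfun_eqI) (simp add: riccati_nonlinearity_def blinfun.bilinear_simps)
  also have "norm \<dots> \<le> \<beta> * norm ?\<Delta> * \<beta>
      + (2 * (b * p) * (1 / c) * (b * norm ?\<Delta>) + (b * p)\<^sup>2 * (\<beta> * norm ?\<Delta> * \<beta> / c\<^sup>2))"
    by (rule order_trans[OF norm_triangle_ineq4 add_mono[OF lin quad]])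
  also have "\<dots> = (\<beta>\<^sup>2 + 2 * b\<^sup>2 * p / c + (b * p * \<beta> / c)\<^sup>2) * norm ?\<Delta>"
    by (simp add: algebra_simps power2_eq_square)
  finally show ?thesis .
qed

section \<open>A backward Gronwall argument\<close>

lemma integral_exp_backward:
  fixes c :: real
  assumes "c > 0" "s \<le> T"
  shows "integral {s..T} (\<lambda>t. exp (2 * c * (T - t))) = (exp (2 * c * (T - s)) - 1) / (2 * c)"
proof -
  have "((\<lambda>t. exp (2 * c * (T - t))) has_integral
      (- exp (2 * c * (T - T)) / (2 * c) - - exp (2 * c * (T - s)) / (2 * c))) {s..T}"
    by (rule fundamental_theorem_of_calculus[OF assms(2)])
      (use assms in \<open>auto intro!: derivative_eq_intros
        simp: has_real_derivative_iff_has_vector_derivative[symmetric]\<close>)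
  then show ?thesis by (simp add: integral_unique diff_divide_distrib)
qed

text \<open>
  The function \<open>f\<close> may fail to be measurable, so the hypothesis speaks about continuous majorants \<open>g\<close> of
  \<open>f\<close> instead of the integral of \<open>f\<close>. Starting from a constant bound, each application of the
  hypothesis to a multiple of \<open>exp (2c(T - t))\<close> halves the multiple, since
  \<open>c\<close> times the integral of this weight over \<open>[s,T]\<close> is at most half its value at \<open>s\<close>.
\<close>

lemma backward_gronwall_zero:
  fixes f :: "real \<Rightarrow> real"
  assumes c: "c > 0"
    and bounded: "\<And>s. s \<in> {0..T} \<Longrightarrow> f s \<le> q"
    and step: "\<And>g s. \<lbrakk>s \<in> {0..T}; continuous_on {s..T} g; \<And>t. t \<in> {s..T} \<Longrightarrow> f t \<le> g t\<rbrakk>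
      \<Longrightarrow> f s \<le> c * integral {s..T} g"
    and s: "s \<in> {0..T}"
  shows "f s \<le> 0"
proof -
  define r where "r = max q 0"
  have "f s \<le> r * (1/2) ^ n * exp (2 * c * (T - s))" if "s \<in> {0..T}" for n s
    using that
  proof (induction n arbitrary: s)
    case 0
    have "r * 1 \<le> r * exp (2 * c * (T - s))"
      using c 0 by (intro mult_left_mono) (auto simp: r_def)
    then show ?case using bounded[OF 0] by (simp add: r_def)
  next
    case (Suc n)
    have "f s \<le> c * integral {s..T} (\<lambda>t. r * (1/2) ^ n * exp (2 * c * (T - t)))"
      using Suc by (intro step continuous_intros) auto
    also have "\<dots> = r * (1/2) ^ Suc n * (exp (2 * c * (T - s)) - 1)"
      using c Suc.prems by (simp add: integral_exp_backward)
    also have "\<dots> \<le> r * (1/2) ^ Suc n * exp (2 * c * (T - s))"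
      by (intro mult_left_mono) (auto simp: r_def)
    finally show ?case .
  qed
  moreover have "(\<lambda>n. r * (1/2) ^ n * exp (2 * c * (T - s))) \<longlonglongrightarrow> r * 0 * exp (2 * c * (T - s))"
    by (intro tendsto_intros LIMSEQ_power_zero) auto
  ultimately show ?thesis
    using LIMSEQ_le_const[of _ "r * 0 * exp (2 * c * (T - s))" "f s"] s by fastforce
qed

section \<open>Uniqueness\<close>

lemma AE_lebesgue_on_tail:
  fixes s T :: real
  assumes "AE t in lebesgue_on {0<..<T}. Q t" and s: "s \<in> {0..T}"
  shows "AE t in lebesgue_on {s..T}. Q t"
proof -
  have "AE t in lebesgue. t \<in> {0<..<T} \<longrightarrow> Q t"
    using assms(1) by (simp add: AE_restrict_space_iff)
  moreover have "AE t in lebesgue. t \<noteq> 0" "AE t in lebesgue. t \<noteq> T"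
    by (intro AE_completion AE_lborel_singleton)+
  ultimately have "AE t in lebesgue. t \<in> {s..T} \<longrightarrow> Q t"
    by eventually_elim (use s in auto)
  then show ?thesis by (simp add: AE_restrict_space_iff)
qed

lemma AE_lebesgue_on_subset:
  assumes "AE t in lebesgue_on X. Q t" "Y \<subseteq> X" "X \<in> sets lebesgue" "Y \<in> sets lebesgue"
  shows "AE t in lebesgue_on Y. Q t"
  using assms by (auto simp: AE_restrict_space_iff elim: eventually_mono)

theorem theorem9p2:
  fixes T :: real
    and domA :: "'h::{real_inner, banach, second_countable_topology} set"
    and A :: "'h \<Rightarrow> 'h"
    and S :: "real \<Rightarrow> ('h \<Rightarrow>\<^sub>L 'h)"
    and B D :: "real \<Rightarrow> ('u::{real_inner, banach} \<Rightarrow>\<^sub>L 'h)"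
    and C M :: "real \<Rightarrow> ('h \<Rightarrow>\<^sub>L 'h)"
    and G :: "'h \<Rightarrow>\<^sub>L 'h"
    and R :: "real \<Rightarrow> ('u \<Rightarrow>\<^sub>L 'u)"
    and P\<^sub>1 P\<^sub>2 :: "real \<Rightarrow> ('h \<Rightarrow>\<^sub>L 'h)"
  assumes "T > 0"
    and "generates_C0_semigroup domA A S"
    and "B \<in> L_infinity T" and "D \<in> L_infinity T" and "C \<in> L_infinity T"
    and "self_adjoint G"
    and "M \<in> L_one T" and "ae_self_adjoint T M"
    and "R \<in> L_infinity T" and "ae_self_adjoint T R"
    and "strongly_regular_mild_solution T S B C D G M R P\<^sub>1"
    and "strongly_regular_mild_solution T S B C D G M R P\<^sub>2"
  shows "\<forall>s\<in>{0..T}. P\<^sub>1 s = P\<^sub>2 s"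
proof -
  let ?\<Delta> = "\<lambda>s. P\<^sub>1 s - P\<^sub>2 s"
  let ?N = "riccati_nonlinearity B C D M R"
  note sol = assms(11,12)[unfolded strongly_regular_mild_solution_def]
  obtain m where m: "m > 0" "\<And>t. t \<in> {0..T} \<Longrightarrow> norm (S t) \<le> m"
  proof -
    obtain k where "\<forall>t\<in>{0..T}. norm (S t) \<le> k"
      using C0_semigroup_bounded assms(2) unfolding generates_C0_semigroup_def by blast
    then show thesis using that[of "max k 1"] by force
  qed
  obtain p where p: "\<And>t. t \<in> {0..T} \<Longrightarrow> norm (P\<^sub>1 t) \<le> p" "\<And>t. t \<in> {0..T} \<Longrightarrow> norm (P\<^sub>2 t) \<le> p"
  proof -
    obtain k l where "\<forall>t\<in>{0..T}. norm (P\<^sub>1 t) \<le> k" "\<forall>t\<in>{0..T}. norm (P\<^sub>2 t) \<le> l"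
      using sol[THEN conjunct1, THEN C_strong_selfadj_bounded] by blast
    then show thesis using that[of "max k l"] by force
  qed
  obtain \<kappa> where \<kappa>: "\<kappa> > 0" and lip: "\<And>s. s \<in> {0..T} \<Longrightarrow>
      AE t in lebesgue_on {s..T}. norm (?N P\<^sub>1 t - ?N P\<^sub>2 t) \<le> \<kappa> * norm (?\<Delta> t)"
  proof -
    obtain \<beta>\<^sub>B \<beta>\<^sub>C \<beta>\<^sub>D where coeff:
      "AE t in lebesgue_on {0<..<T}. norm (B t) \<le> \<beta>\<^sub>B"
      "AE t in lebesgue_on {0<..<T}. norm (C t) \<le> \<beta>\<^sub>C"
      "AE t in lebesgue_on {0<..<T}. norm (D t) \<le> \<beta>\<^sub>D"
      using assms(3-5) by (auto simp: L_infinity_def)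
    obtain c\<^sub>1 c\<^sub>2 where pos: "c\<^sub>1 > 0" "c\<^sub>2 > 0" and coercive:
      "AE t in lebesgue_on {0..T}. op_ge_scalar (riccati_K D R P\<^sub>1 t) c\<^sub>1"
      "AE t in lebesgue_on {0..T}. op_ge_scalar (riccati_K D R P\<^sub>2 t) c\<^sub>2"
      using sol[THEN conjunct2, THEN conjunct2] by blast
    define \<beta> where "\<beta> = max \<beta>\<^sub>B (max \<beta>\<^sub>C \<beta>\<^sub>D)"
    define c where "c = min c\<^sub>1 c\<^sub>2"
    define \<rho> where "\<rho> = \<beta>\<^sup>2 + 2 * (\<beta> + \<beta>\<^sup>2)\<^sup>2 * p / c + ((\<beta> + \<beta>\<^sup>2) * p * \<beta> / c)\<^sup>2"
    have c: "c > 0" using pos by (simp add: c_def)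
    have "AE t in lebesgue_on {s..T}. norm (?N P\<^sub>1 t - ?N P\<^sub>2 t) \<le> max \<rho> 1 * norm (?\<Delta> t)"
      if s: "s \<in> {0..T}" for s
    proof -
      have tail: "{s..T} \<subseteq> {0..T}" "{0..T} \<in> sets lebesgue" "{s..T} \<in> sets lebesgue"
        using s by auto
      have "AE t in lebesgue_on {s..T}. t \<in> {s..T}"
        by (rule AE_I2) simp
      then show ?thesis
        using coeff[THEN AE_lebesgue_on_tail[OF _ s]]
          AE_lebesgue_on_subset[OF coercive(1) tail] AE_lebesgue_on_subset[OF coercive(2) tail]
      proof eventually_elim
        case (elim t)
        then have t: "t \<in> {0..T}" using s by auto
        have "norm (?N P\<^sub>1 t - ?N P\<^sub>2 t) \<le> \<rho> * norm (?\<Delta> t)"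
          unfolding \<rho>_def
          by (rule riccati_nonlinearity_lipschitz[where s = t and B = B and C = C and D = D
                and R = R and P\<^sub>1 = P\<^sub>1 and P\<^sub>2 = P\<^sub>2])
            (use elim p[OF t] c in \<open>auto simp: \<beta>_def c_def intro: op_ge_scalar_mono\<close>)
        also have "\<dots> \<le> max \<rho> 1 * norm (?\<Delta> t)" by (intro mult_right_mono) auto
        finally show ?case .
      qed
    qed
    \<comment> \<open>The maximum with 1 makes the constant strictly positive, as the Gronwall lemma requires.\<close>
    then show thesis using that[of "max \<rho> 1"] by simp
  qed
  have step: "norm (?\<Delta> s) \<le> m * \<kappa> * m * integral {s..T} g"
    if s: "s \<in> {0..T}" and cont: "continuous_on {s..T} g"
      and le: "\<And>t. t \<in> {s..T} \<Longrightarrow> norm (?\<Delta> t) \<le> g t" for g s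
  proof (rule norm_blinfun_bound)
    have int_g: "integrable (lebesgue_on {s..T}) g"
      by (rule continuous_imp_integrable_real[OF cont])
    have integral_g: "integral\<^sup>L (lebesgue_on {s..T}) g = integral {s..T} g"
      by (rule lebesgue_integral_eq_integral[OF int_g]) simp
    have "0 \<le> integral {s..T} g"
      by (rule integral_nonneg[OF integrable_continuous_real[OF cont]])
        (meson le norm_ge_zero order_trans)
    then show "0 \<le> m * \<kappa> * m * integral {s..T} g" using m(1) \<kappa> by simp
    fix \<eta>
    \<comment> \<open>The integrand of the difference of the two mild equations, in which the terms with \<open>G\<close> cancel.\<close>
    define \<Phi> where "\<Phi> t = (adj (S (t - s)) o\<^sub>L (?N P\<^sub>1 t - ?N P\<^sub>2 t) o\<^sub>L S (t - s)) \<eta>" for t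
    have integral_\<Phi>: "has_bochner_integral (lebesgue_on {s..T}) \<Phi> (?\<Delta> s \<eta>)"
    proof -
      have "has_bochner_integral (lebesgue_on {s..T})
          (\<lambda>t. (adj (S (t - s)) o\<^sub>L ?N P\<^sub>1 t o\<^sub>L S (t - s)) \<eta> - (adj (S (t - s)) o\<^sub>L ?N P\<^sub>2 t o\<^sub>L S (t - s)) \<eta>)
          ((P\<^sub>1 s \<eta> - (adj (S (T - s)) o\<^sub>L G o\<^sub>L S (T - s)) \<eta>)
            - (P\<^sub>2 s \<eta> - (adj (S (T - s)) o\<^sub>L G o\<^sub>L S (T - s)) \<eta>))"
        by (intro has_bochner_integral_diff sol[THEN conjunct2, THEN conjunct1, rule_format] s)
      then show ?thesis by (simp add: \<Phi>_def[abs_def] blinfun.bilinear_simps)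
    qed
    then have "norm (?\<Delta> s \<eta>) \<le> (\<integral>t. norm (\<Phi> t) \<partial>lebesgue_on {s..T})"
      by (metis has_bochner_integral_iff integral_norm_bound)
    also have "\<dots> \<le> (\<integral>t. m * \<kappa> * m * norm \<eta> * g t \<partial>lebesgue_on {s..T})"
    proof (rule integral_mono_AE)
      show "integrable (lebesgue_on {s..T}) (\<lambda>t. norm (\<Phi> t))"
        using integral_\<Phi> by (auto simp: has_bochner_integral_iff)
      show "integrable (lebesgue_on {s..T}) (\<lambda>t. m * \<kappa> * m * norm \<eta> * g t)"
        using int_g by simp
      have "AE t in lebesgue_on {s..T}. t \<in> {s..T}"
        by (rule AE_I2) simp
      then show "AE t in lebesgue_on {s..T}. norm (\<Phi> t) \<le> m * \<kappa> * m * norm \<eta> * g t"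
        using lip[OF s]
      proof eventually_elim
        case (elim t)
        have "norm (S (t - s)) \<le> m" using elim s by (intro m) auto
        moreover have "norm (?N P\<^sub>1 t - ?N P\<^sub>2 t) \<le> \<kappa> * g t"
          using elim le[of t] \<kappa> by (meson less_imp_le mult_left_mono order_trans)
        ultimately have "norm (adj (S (t - s)) o\<^sub>L (?N P\<^sub>1 t - ?N P\<^sub>2 t) o\<^sub>L S (t - s)) \<le> m * (\<kappa> * g t) * m"
          by (intro norm_compose_le) (auto intro: order_trans[OF norm_adj_le])
        then have "norm (\<Phi> t) \<le> m * (\<kappa> * g t) * m * norm \<eta>"
          unfolding \<Phi>_def by (meson mult_right_mono norm_blinfun norm_ge_zero order_trans)
        then show ?case by (simp add: algebra_simps)
      qed
    qed
    also have "\<dots> = m * \<kappa> * m * integral {s..T} g * norm \<eta>" by (simp add: integral_g)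
    finally show "norm (?\<Delta> s \<eta>) \<le> m * \<kappa> * m * integral {s..T} g * norm \<eta>" .
  qed
  have "norm (?\<Delta> s) \<le> 2 * p" if "s \<in> {0..T}" for s
    using norm_triangle_ineq4[of "P\<^sub>1 s" "P\<^sub>2 s"] p[OF that] by linarith
  moreover have "m * \<kappa> * m > 0" using m(1) \<kappa> by simp
  ultimately have "norm (?\<Delta> s) \<le> 0" if "s \<in> {0..T}" for s
    using backward_gronwall_zero[where f = "\<lambda>s. norm (?\<Delta> s)" and T = T, OF _ _ step that]
    by blast
  then show ?thesis by simp
qed

end
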